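(* Let $S$ be a monoid. The following are equivalent: (i) finite products of indecomposable right $S$-acts are indecomposable; (ii) finite products of cyclic right $S$-acts are indecomposable; (iii) the right $S$-act $S^n$ is indecomposable for each $n\in\mathbb{N}$; (iv) the right $S$-act $S^n$ is indecomposable for some $n\in\mathbb{N}$ with $n\neq 1$; (v) the right $S$-act $S\times S$ is indecomposable; (vi) the one-element left $S$-act ${}_S\Theta$ is finitely product flat.
   Context: Here $\mathbb{N}=\{1,2,3,\dots\}$. A right $S$-act over a monoid $S$ is a nonempty set $A$ with a map $A\times S\to A$, $(a,s)\mapsto as$, such that $a(st)=(as)t$ and $a1=a$ for all $a\in A$, $s,t\in S$; left $S$-acts are defined dually. A subact is a nonempty subset closed under the action; a right $S$-act $C$ is cyclic if $C=cS$ for some $c\in C$. A right $S$-act $A$ is decomposable if there are subacts $B,C\subseteq A$ (both nonempty) with $A=B\cup C$ and $B\cap C=\emptyset$; otherwise it is indecomposable. Products of acts are Cartesian products with componentwise action; in particular $S^n$ and $S\times S$ carry the action $(s_1,\dots,s_n)s=(s_1s,\dots,s_ns)$. For a right $S$-act $A$ and a left $S$-act $B$, $A\otimes B$ is the quotient of the set $A\times B$ by the equivalence relation generated by the pairs $((as,b),(a,sb))$, $a\in A$, $b\in B$, $s\in S$. A left $S$-act $B$ is finitely product flat if the functor $-\otimes B$ from the category of right $S$-acts to the category of sets preserves all finite products. *)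

theory Defs
  imports "HOL-Algebra.Group" "HOL-Library.FuncSet" "HOL-Library.Equipollence"
begin

section \<open>Acts over a monoid\<close>

record ('a, 's) ract =
  rpoints :: "'a set"
  raction :: "'a \<Rightarrow> 's \<Rightarrow> 'a"

record ('a, 's) lact =
  lpoints :: "'a set"
  laction :: "'s \<Rightarrow> 'a \<Rightarrow> 'a"

definition right_act :: "('s, 'm) monoid_scheme \<Rightarrow> ('a, 's) ract \<Rightarrow> bool" where
  "right_act S A \<longleftrightarrow>
     rpoints A \<noteq> {} \<and>
     (\<forall>a\<in>rpoints A. \<forall>s\<in>carrier S. raction A a s \<in> rpoints A) \<and>
     (\<forall>a\<in>rpoints A. \<forall>s\<in>carrier S. \<forall>t\<in>carrier S.
        raction A a (s \<otimes>\<^bsub>S\<^esub> t) = raction A (raction A a s) t) \<and>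
     (\<forall>a\<in>rpoints A. raction A a \<one>\<^bsub>S\<^esub> = a)"

definition left_act :: "('s, 'm) monoid_scheme \<Rightarrow> ('a, 's) lact \<Rightarrow> bool" where
  "left_act S B \<longleftrightarrow>
     lpoints B \<noteq> {} \<and>
     (\<forall>b\<in>lpoints B. \<forall>s\<in>carrier S. laction B s b \<in> lpoints B) \<and>
     (\<forall>b\<in>lpoints B. \<forall>s\<in>carrier S. \<forall>t\<in>carrier S.
        laction B (s \<otimes>\<^bsub>S\<^esub> t) b = laction B s (laction B t b)) \<and>
     (\<forall>b\<in>lpoints B. laction B \<one>\<^bsub>S\<^esub> b = b)"

definition subact :: "('s, 'm) monoid_scheme \<Rightarrow> 'a set \<Rightarrow> ('a, 's) ract \<Rightarrow> bool" where
  "subact S B A \<longleftrightarrow>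
     B \<noteq> {} \<and> B \<subseteq> rpoints A \<and> (\<forall>b\<in>B. \<forall>s\<in>carrier S. raction A b s \<in> B)"

definition cyclic :: "('s, 'm) monoid_scheme \<Rightarrow> ('a, 's) ract \<Rightarrow> bool" where
  "cyclic S C \<longleftrightarrow>
     right_act S C \<and> (\<exists>c\<in>rpoints C. rpoints C = raction C c ` carrier S)"

definition decomposable :: "('s, 'm) monoid_scheme \<Rightarrow> ('a, 's) ract \<Rightarrow> bool" where
  "decomposable S A \<longleftrightarrow>
     right_act S A \<and>
     (\<exists>B C. subact S B A \<and> subact S C A \<and> rpoints A = B \<union> C \<and> B \<inter> C = {})"

definition indecomposable :: "('s, 'm) monoid_scheme \<Rightarrow> ('a, 's) ract \<Rightarrow> bool" where
  "indecomposable S A \<longleftrightarrow> right_act S A \<and> \<not> decomposable S A"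

definition regular_ract :: "('s, 'm) monoid_scheme \<Rightarrow> ('s, 's) ract" where
  "regular_ract S = \<lparr>rpoints = carrier S, raction = (\<lambda>a s. a \<otimes>\<^bsub>S\<^esub> s)\<rparr>"

definition prod_ract :: "'i set \<Rightarrow> ('i \<Rightarrow> ('a, 's) ract) \<Rightarrow> ('i \<Rightarrow> 'a, 's) ract" where
  "prod_ract I A =
     \<lparr>rpoints = (\<Pi>\<^sub>E i\<in>I. rpoints (A i)),
      raction = (\<lambda>a s. \<lambda>i\<in>I. raction (A i) (a i) s)\<rparr>"

definition pair_ract :: "('a, 's) ract \<Rightarrow> ('b, 's) ract \<Rightarrow> ('a \<times> 'b, 's) ract" where
  "pair_ract A B =
     \<lparr>rpoints = rpoints A \<times> rpoints B,
      raction = (\<lambda>(a, b) s. (raction A a s, raction B b s))\<rparr>"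

definition power_ract :: "('s, 'm) monoid_scheme \<Rightarrow> nat \<Rightarrow> (nat \<Rightarrow> 's, 's) ract" where
  "power_ract S n = prod_ract {1..n} (\<lambda>_. regular_ract S)"

definition one_lact :: "(unit, 's) lact" where
  "one_lact = \<lparr>lpoints = {()}, laction = (\<lambda>_ b. b)\<rparr>"


section \<open>Tensor products and product flatness\<close>

definition tensor_gen ::
  "('s, 'm) monoid_scheme \<Rightarrow> ('a, 's) ract \<Rightarrow> ('b, 's) lact \<Rightarrow> 'a \<times> 'b \<Rightarrow> 'a \<times> 'b \<Rightarrow> bool" where
  "tensor_gen S A B p q \<longleftrightarrow>
     (\<exists>a\<in>rpoints A. \<exists>b\<in>lpoints B. \<exists>s\<in>carrier S.
        p = (raction A a s, b) \<and> q = (a, laction B s b))"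

text \<open>For acts \<open>A\<close> and \<open>B\<close> all generating pairs lie in \<open>rpoints A \<times> lpoints B\<close>, so
  \<^const>\<open>equivclp\<close> only adds the identity outside that set, and the classes of its elements
  are those of the equivalence relation generated on it.\<close>

definition tensor_rel ::
  "('s, 'm) monoid_scheme \<Rightarrow> ('a, 's) ract \<Rightarrow> ('b, 's) lact \<Rightarrow> (('a \<times> 'b) \<times> ('a \<times> 'b)) set" where
  "tensor_rel S A B = {(p, q). equivclp (tensor_gen S A B) p q}"

definition tensor ::
  "('s, 'm) monoid_scheme \<Rightarrow> ('a, 's) ract \<Rightarrow> ('b, 's) lact \<Rightarrow> ('a \<times> 'b) set set" where
  "tensor S A B = (rpoints A \<times> lpoints B) // tensor_rel S A B"

text \<open>The functor \<open>- \<otimes> B\<close> on an act homomorphism \<open>f\<close> into \<open>A\<close>: it sends the class of \<open>(x, b)\<close>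
  to the class of \<open>(f x, b)\<close>. All members of the union are the same class, as the result does
  not depend on the representative.\<close>

definition tensor_map ::
  "('s, 'm) monoid_scheme \<Rightarrow> ('a, 's) ract \<Rightarrow> ('b, 's) lact \<Rightarrow> ('c \<Rightarrow> 'a)
     \<Rightarrow> ('c \<times> 'b) set \<Rightarrow> ('a \<times> 'b) set" where
  "tensor_map S A B f X = (\<Union>(x, b)\<in>X. tensor_rel S A B `` {(f x, b)})"

text \<open>The canonical map from \<open>(\<Prod>i. A i) \<otimes> B\<close> to \<open>\<Prod>i. (A i \<otimes> B)\<close> whose components are the
  images of the projections under \<open>- \<otimes> B\<close>.\<close>

definition tensor_comparison ::
  "('s, 'm) monoid_scheme \<Rightarrow> 'i set \<Rightarrow> ('i \<Rightarrow> ('a, 's) ract) \<Rightarrow> ('b, 's) lact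
     \<Rightarrow> (('i \<Rightarrow> 'a) \<times> 'b) set \<Rightarrow> 'i \<Rightarrow> ('a \<times> 'b) set" where
  "tensor_comparison S I A B X = (\<lambda>i\<in>I. tensor_map S (A i) B (\<lambda>a. a i) X)"

text \<open>The functor preserves a product iff the comparison map is an isomorphism of sets.
  The type argument is the universe over which the right acts range; finite families are
  indexed by finite sets of natural numbers, and the empty product is included.\<close>

definition finitely_product_flat ::
  "'a itself \<Rightarrow> ('s, 'm) monoid_scheme \<Rightarrow> ('b, 's) lact \<Rightarrow> bool" where
  "finitely_product_flat (_ :: 'a itself) S B \<longleftrightarrow>
     left_act S B \<and>
     (\<forall>(I :: nat set) (A :: nat \<Rightarrow> ('a, 's) ract).
        finite I \<and> (\<forall>i\<in>I. right_act S (A i)) \<longrightarrow>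
        bij_betw (tensor_comparison S I A B)
          (tensor S (prod_ract I A) B) (\<Pi>\<^sub>E i\<in>I. tensor S (A i) B))"

end

theory Submission
  imports Defs
begin

text \<open>An act is indecomposable iff any two of its points are joined by a zigzag of steps
  \<open>x \<mapsto> x s\<close>, and homomorphisms preserve zigzags. If \<open>S \<times> S\<close> is connected, then a single coordinate
  of a point \<open>x\<close> of any product can be moved by \<open>s\<close>: the map \<open>S \<times> S \<rightarrow> \<Prod>i. A i\<close> that sends \<open>(s, t)\<close>
  to the point with coordinates \<open>x i s\<close> and \<open>x j t\<close> for \<open>j \<noteq> i\<close> is a homomorphism, and \<open>(1, 1)\<close>
  and \<open>(s, 1)\<close> are connected. Changing finitely many coordinates in turn shows that finite products
  are connected componentwise. Conversely, \<open>S \<times> S\<close> is a homomorphic image of \<open>S\<^sup>n\<close> for \<open>n \<ge> 2\<close>,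
  and \<open>A \<otimes> \<Theta>\<close> is the set of connected components of \<open>A\<close>.\<close>

section \<open>Connectedness by zigzags\<close>

definition act_step :: "('s, 'm) monoid_scheme \<Rightarrow> ('a, 's) ract \<Rightarrow> 'a \<Rightarrow> 'a \<Rightarrow> bool" where
  "act_step S A x y \<longleftrightarrow> x \<in> rpoints A \<and> (\<exists>s\<in>carrier S. y = raction A x s)"

abbreviation act_conn :: "('s, 'm) monoid_scheme \<Rightarrow> ('a, 's) ract \<Rightarrow> 'a \<Rightarrow> 'a \<Rightarrow> bool" where
  "act_conn S A \<equiv> equivclp (act_step S A)"

text \<open>The preimage of an equivalence relation under \<open>f\<close> is an equivalence
  relation, so it suffices to check the generating pairs. With equality as \<open>Q\<close>, this
  turns invariance under single steps into invariance along zigzags.\<close>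

lemma equivclp_map:
  assumes "equivclp R a b" and "\<And>x y. R x y \<Longrightarrow> equivclp Q (f x) (f y)"
  shows "equivclp Q (f a) (f b)"
  using assms(1)
proof (induction rule: equivclp_induct)
  case base
  show ?case by simp
next
  case (step y z)
  then show ?case
    using assms(2) by (meson equivclp_sym equivclp_trans)
qed

lemma act_conn_hom:
  assumes "act_conn S A x y"
    and "\<And>x. x \<in> rpoints A \<Longrightarrow> f x \<in> rpoints B"
    and "\<And>x s. x \<in> rpoints A \<Longrightarrow> s \<in> carrier S \<Longrightarrow> f (raction A x s) = raction B (f x) s"
  shows "act_conn S B (f x) (f y)"
  using assms(1)
proof (rule equivclp_map)
  fix u v assume "act_step S A u v"
  then have "act_step S B (f u) (f v)"
    using assms(2,3) unfolding act_step_def by blast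
  then show "act_conn S B (f u) (f v)" by (rule r_into_equivclp)
qed

lemma right_act_closed:
  "right_act S A \<Longrightarrow> a \<in> rpoints A \<Longrightarrow> s \<in> carrier S \<Longrightarrow> raction A a s \<in> rpoints A"
  unfolding right_act_def by blast

lemma right_act_mult:
  "right_act S A \<Longrightarrow> a \<in> rpoints A \<Longrightarrow> s \<in> carrier S \<Longrightarrow> t \<in> carrier S
    \<Longrightarrow> raction A a (s \<otimes>\<^bsub>S\<^esub> t) = raction A (raction A a s) t"
  unfolding right_act_def by blast

lemma right_act_one: "right_act S A \<Longrightarrow> a \<in> rpoints A \<Longrightarrow> raction A a \<one>\<^bsub>S\<^esub> = a"
  unfolding right_act_def by blast

text \<open>A point and its translates are connected, so the component of \<open>x\<close> and its
  complement are both closed under the action; if the complement were nonempty, they would decompose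
  the act. Conversely, no step crosses between the two parts of a decomposition, because both are
  closed.\<close>

lemma indecomposable_iff_conn:
  "indecomposable S A \<longleftrightarrow> right_act S A \<and> (\<forall>x\<in>rpoints A. \<forall>y\<in>rpoints A. act_conn S A x y)"
proof (intro iffI conjI ballI)
  assume "indecomposable S A"
  then show act: "right_act S A" by (simp add: indecomposable_def)
  fix x y assume x: "x \<in> rpoints A" and y: "y \<in> rpoints A"
  let ?B = "{z \<in> rpoints A. act_conn S A x z}" and ?C = "{z \<in> rpoints A. \<not> act_conn S A x z}"
  have iff: "act_conn S A x z \<longleftrightarrow> act_conn S A x (raction A z s)"
    if "z \<in> rpoints A" "s \<in> carrier S" for z s
  proof -
    have "act_conn S A z (raction A z s)"
      using that by (intro r_into_equivclp) (auto simp: act_step_def)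
    then show ?thesis by (meson equivclp_sym equivclp_trans)
  qed
  show "act_conn S A x y"
  proof (rule ccontr)
    assume "\<not> act_conn S A x y"
    with x y have "?B \<noteq> {}" "?C \<noteq> {}" by auto
    then have "subact S ?B A" "subact S ?C A"
      using iff right_act_closed[OF act] unfolding subact_def by auto
    moreover have "rpoints A = ?B \<union> ?C" "?B \<inter> ?C = {}" by auto
    ultimately have "decomposable S A" using act unfolding decomposable_def by blast
    with \<open>indecomposable S A\<close> show False by (simp add: indecomposable_def)
  qed
next
  assume asm: "right_act S A \<and> (\<forall>x\<in>rpoints A. \<forall>y\<in>rpoints A. act_conn S A x y)"
  have False if dec: "decomposable S A"
  proof -
    obtain B C where BC: "subact S B A" "subact S C A" "rpoints A = B \<union> C" "B \<inter> C = {}"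
      using dec unfolding decomposable_def by blast
    obtain b c where bc: "b \<in> B" "c \<in> C" using BC unfolding subact_def by blast
    then have "act_conn S A b c" using BC asm by blast
    \<comment> \<open>Membership in \<open>B\<close> is constant along steps: a step that starts in
      \<open>C\<close> stays in \<open>C\<close>, which is disjoint from \<open>B\<close>.\<close>
    then have "equivclp (=) (b \<in> B) (c \<in> B)"
    proof (rule equivclp_map[where f = "\<lambda>x. x \<in> B"])
      fix x y assume "act_step S A x y"
      then have "(x \<in> B) = (y \<in> B)"
        using BC unfolding act_step_def subact_def by blast
      then show "equivclp (=) (x \<in> B) (y \<in> B)" by simp
    qed
    then have "c \<in> B" using bc by (induction rule: equivclp_induct) auto
    then show False using bc BC by blast
  qed
  then show "indecomposable S A" using asm unfolding indecomposable_def by blast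
qed

lemma indecomposable_hom_image:
  assumes "indecomposable S A" and "right_act S B"
    and "f ` rpoints A = rpoints B"
    and "\<And>x s. x \<in> rpoints A \<Longrightarrow> s \<in> carrier S \<Longrightarrow> f (raction A x s) = raction B (f x) s"
  shows "indecomposable S B"
  unfolding indecomposable_iff_conn
proof (intro conjI ballI)
  fix x y assume "x \<in> rpoints B" "y \<in> rpoints B"
  then obtain u v where uv: "u \<in> rpoints A" "v \<in> rpoints A" "x = f u" "y = f v"
    using assms(3) by (metis imageE)
  then have "act_conn S A u v" using assms(1) by (simp add: indecomposable_iff_conn)
  then show "act_conn S B x y"
    unfolding uv(3,4) by (rule act_conn_hom) (use assms(3,4) in auto)
qed (rule assms(2))

section \<open>Products, regular acts and cyclic acts\<close>

lemma right_act_prod: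
  assumes "monoid S" and "\<And>i. i \<in> I \<Longrightarrow> right_act S (A i)"
  shows "right_act S (prod_ract I A)"
  unfolding right_act_def
proof (intro conjI ballI)
  show "rpoints (prod_ract I A) \<noteq> {}"
    using assms(2) by (auto simp: prod_ract_def PiE_eq_empty_iff right_act_def)
next
  fix a s assume "a \<in> rpoints (prod_ract I A)" "s \<in> carrier S"
  then show "raction (prod_ract I A) a s \<in> rpoints (prod_ract I A)"
    using right_act_closed[OF assms(2)] by (auto simp: prod_ract_def PiE_mem)
next
  fix a s t assume "a \<in> rpoints (prod_ract I A)" and st: "s \<in> carrier S" "t \<in> carrier S"
  then have "a i \<in> rpoints (A i)" if "i \<in> I" for i
    using that by (auto simp: prod_ract_def)
  then show "raction (prod_ract I A) a (s \<otimes>\<^bsub>S\<^esub> t) =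
      raction (prod_ract I A) (raction (prod_ract I A) a s) t"
    using right_act_mult[OF assms(2) _ st] by (auto simp: prod_ract_def intro!: restrict_ext)
next
  fix a assume "a \<in> rpoints (prod_ract I A)"
  then have a: "a \<in> (\<Pi>\<^sub>E i\<in>I. rpoints (A i))" by (simp add: prod_ract_def)
  then have "(\<lambda>i\<in>I. raction (A i) (a i) \<one>\<^bsub>S\<^esub>) = restrict a I"
    by (intro restrict_ext right_act_one[OF assms(2)]) auto
  then show "raction (prod_ract I A) a \<one>\<^bsub>S\<^esub> = a"
    using PiE_restrict[OF a] by (simp add: prod_ract_def)
qed

lemma right_act_regular: "monoid S \<Longrightarrow> right_act S (regular_ract S)"
  unfolding right_act_def regular_ract_def
  using monoid.m_closed monoid.one_closed monoid.r_one monoid.m_assoc by fastforce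

lemma right_act_pair:
  assumes "right_act S A" and "right_act S B"
  shows "right_act S (pair_ract A B)"
  using assms unfolding right_act_def pair_ract_def by auto

lemma cyclic_imp_indecomposable:
  assumes "cyclic S C"
  shows "indecomposable S C"
  unfolding indecomposable_iff_conn
proof (intro conjI ballI)
  show "right_act S C" using assms by (simp add: cyclic_def)
  obtain c where c: "c \<in> rpoints C" "rpoints C = raction C c ` carrier S"
    using assms by (auto simp: cyclic_def)
  have conn: "act_conn S C c x" if "x \<in> rpoints C" for x
    using that c by (intro r_into_equivclp) (auto simp: act_step_def)
  fix x y assume "x \<in> rpoints C" "y \<in> rpoints C"
  then show "act_conn S C x y" using conn by (meson equivclp_sym equivclp_trans)
qed

lemma cyclic_regular:
  assumes "monoid S"
  shows "cyclic S (regular_ract S)"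
proof -
  interpret monoid S by fact
  have "carrier S = (\<lambda>s. \<one>\<^bsub>S\<^esub> \<otimes>\<^bsub>S\<^esub> s) ` carrier S" by (auto simp: image_iff)
  then show ?thesis
    using right_act_regular[OF assms]
    by (auto simp: cyclic_def regular_ract_def intro!: bexI[of _ "\<one>\<^bsub>S\<^esub>"])
qed

section \<open>Connectedness of finite products\<close>

lemma act_conn_fun_upd:
  assumes "monoid S" and SS: "indecomposable S (pair_ract (regular_ract S) (regular_ract S))"
    and act: "\<And>i. i \<in> I \<Longrightarrow> right_act S (A i)"
    and x: "x \<in> rpoints (prod_ract I A)" and "i \<in> I"
    and conn: "act_conn S (A i) a b"
  shows "act_conn S (prod_ract I A) (x(i := a)) (x(i := b))"
  using conn
proof (rule equivclp_map[where f = "\<lambda>c. x(i := c)"])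
  interpret monoid S by fact
  fix c d assume "act_step S (A i) c d"
  then obtain s where c: "c \<in> rpoints (A i)" and s: "s \<in> carrier S" "d = raction (A i) c s"
    by (auto simp: act_step_def)
  \<comment> \<open>The base point from which \<open>f\<close> moves: \<open>x\<close> with
    coordinate \<open>i\<close> at the start of the step. In each coordinate \<open>f\<close> is an
    orbit map of \<open>z j\<close>, hence a homomorphism; it sends (1, 1) to \<open>z\<close> and
    (s, 1) to \<open>z\<close> with only coordinate \<open>i\<close> moved.\<close>
  define z where "z = x(i := c)"
  have z: "z j \<in> rpoints (A j)" if "j \<in> I" for j
    using x c that by (auto simp: z_def prod_ract_def PiE_mem)
  have z_i: "z i = c" by (simp add: z_def)
  define f where "f = (\<lambda>(s, t). \<lambda>j\<in>I. raction (A j) (z j) (if j = i then s else t))"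
  have "act_conn S (pair_ract (regular_ract S) (regular_ract S)) (\<one>\<^bsub>S\<^esub>, \<one>\<^bsub>S\<^esub>) (s, \<one>\<^bsub>S\<^esub>)"
    using SS s by (auto simp: indecomposable_iff_conn pair_ract_def regular_ract_def)
  then have "act_conn S (prod_ract I A) (f (\<one>\<^bsub>S\<^esub>, \<one>\<^bsub>S\<^esub>)) (f (s, \<one>\<^bsub>S\<^esub>))"
  proof (rule act_conn_hom)
    fix p assume "p \<in> rpoints (pair_ract (regular_ract S) (regular_ract S))"
    then show "f p \<in> rpoints (prod_ract I A)"
      using right_act_closed[OF act] z
      by (auto simp: f_def pair_ract_def regular_ract_def prod_ract_def)
  next
    fix p u assume "p \<in> rpoints (pair_ract (regular_ract S) (regular_ract S))" "u \<in> carrier S"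
    then show "f (raction (pair_ract (regular_ract S) (regular_ract S)) p u)
        = raction (prod_ract I A) (f p) u"
      using right_act_mult[OF act] z
      by (auto simp: f_def pair_ract_def regular_ract_def prod_ract_def intro!: restrict_ext)
  qed
  \<comment> \<open>Points of the product are \<open>undefined\<close> off \<open>I\<close>, so the
    restrictions to \<open>I\<close> below agree with the plain updates of \<open>x\<close>.\<close>
  moreover have ext: "x \<in> extensional I" using x by (auto simp: prod_ract_def PiE_def)
  have "f (\<one>\<^bsub>S\<^esub>, \<one>\<^bsub>S\<^esub>) = restrict z I"
    using right_act_one[OF act z] by (auto simp: f_def intro!: restrict_ext)
  then have "f (\<one>\<^bsub>S\<^esub>, \<one>\<^bsub>S\<^esub>) = x(i := c)"
    using ext \<open>i \<in> I\<close> by (auto simp: z_def fun_eq_iff extensional_def)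
  moreover have "f (s, \<one>\<^bsub>S\<^esub>) = restrict (z(i := d)) I"
    using right_act_one[OF act z] s(2) by (auto simp: f_def z_def[symmetric] z_i intro!: restrict_ext)
  then have "f (s, \<one>\<^bsub>S\<^esub>) = x(i := d)"
    using ext \<open>i \<in> I\<close> by (auto simp: z_def fun_eq_iff extensional_def)
  ultimately show "act_conn S (prod_ract I A) (x(i := c)) (x(i := d))" by simp
qed

text \<open>The factors may be disconnected here: the product flatness of the one-element act
  concerns arbitrary acts and needs this componentwise form.\<close>

lemma act_conn_prod:
  assumes "monoid S" and SS: "indecomposable S (pair_ract (regular_ract S) (regular_ract S))"
    and act: "\<And>i. i \<in> I \<Longrightarrow> right_act S (A i)" and "finite I"
    and x: "x \<in> rpoints (prod_ract I A)" and y: "y \<in> rpoints (prod_ract I A)"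
    and conn: "\<And>i. i \<in> I \<Longrightarrow> act_conn S (A i) (x i) (y i)"
  shows "act_conn S (prod_ract I A) x y"
proof -
  \<comment> \<open>\<open>J\<close> is the set of coordinates already switched from
    \<open>x\<close> to \<open>y\<close>.\<close>
  have override: "act_conn S (prod_ract I A) x (override_on x y J)" if "finite J" "J \<subseteq> I" for J
    using that
  proof (induction rule: finite_induct)
    case empty
    show ?case by simp
  next
    case (insert i J)
    let ?w = "override_on x y J"
    have w: "?w \<in> rpoints (prod_ract I A)"
      using x y insert.prems by (auto simp: prod_ract_def override_on_def PiE_iff extensional_def)
    have "?w i = x i" using insert.hyps by (simp add: override_on_def)
    then have "?w(i := x i) = ?w" by (metis fun_upd_triv)
    moreover have "?w(i := y i) = override_on x y (insert i J)"
      by (auto simp: override_on_def)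
    moreover have "act_conn S (prod_ract I A) (?w(i := x i)) (?w(i := y i))"
      using insert.prems by (intro act_conn_fun_upd[OF assms(1) SS act w] conn) auto
    ultimately have "act_conn S (prod_ract I A) ?w (override_on x y (insert i J))" by simp
    with insert show ?case by (auto intro: equivclp_trans)
  qed
  have "act_conn S (prod_ract I A) x (override_on x y I)"
    using override[OF \<open>finite I\<close>] by simp
  moreover have "override_on x y I = y"
    using x y by (intro ext) (auto simp: override_on_def prod_ract_def PiE_iff extensional_def)
  ultimately show ?thesis by simp
qed

lemma indecomposable_prod:
  assumes "monoid S" and "indecomposable S (pair_ract (regular_ract S) (regular_ract S))"
    and "finite I" and "\<And>i. i \<in> I \<Longrightarrow> indecomposable S (A i)"
  shows "indecomposable S (prod_ract I A)"
  unfolding indecomposable_iff_conn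
proof (intro conjI ballI)
  have act: "right_act S (A i)" if "i \<in> I" for i
    using assms(4)[OF that] by (simp add: indecomposable_iff_conn)
  then show "right_act S (prod_ract I A)" using assms(1) by (rule right_act_prod[rotated])
  fix x y assume xy: "x \<in> rpoints (prod_ract I A)" "y \<in> rpoints (prod_ract I A)"
  show "act_conn S (prod_ract I A) x y"
  proof (rule act_conn_prod[OF assms(1,2) act assms(3) xy])
    fix i assume "i \<in> I"
    then show "act_conn S (A i) (x i) (y i)"
      using assms(4) xy by (auto simp: indecomposable_iff_conn prod_ract_def PiE_iff)
  qed
qed

section \<open>Recovering S \<times> S from other products\<close>

text \<open>Projecting to the coordinates \<open>i\<close> and \<open>j\<close> and then applying
  \<open>g\<close> is a homomorphism onto S \<times> S. The map \<open>g\<close> allows the two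
  factors to be copies of the regular act on another type.\<close>

lemma indecomposable_pair_of_prod:
  assumes "monoid S" and "indecomposable S (prod_ract I A)"
    and ij: "i \<in> I" "j \<in> I" "i \<noteq> j"
    and g: "\<And>k. k \<in> {i, j} \<Longrightarrow> g ` rpoints (A k) = carrier S"
    and hom: "\<And>k x s. k \<in> {i, j} \<Longrightarrow> x \<in> rpoints (A k) \<Longrightarrow> s \<in> carrier S
      \<Longrightarrow> g (raction (A k) x s) = g x \<otimes>\<^bsub>S\<^esub> s"
  shows "indecomposable S (pair_ract (regular_ract S) (regular_ract S))"
  using assms(2)
proof (rule indecomposable_hom_image[where f = "\<lambda>x. (g (x i), g (x j))"])
  show "right_act S (pair_ract (regular_ract S) (regular_ract S))"
    using assms(1) by (intro right_act_pair right_act_regular)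
next
  \<comment> \<open>An arbitrary point, which fills the remaining coordinates of a preimage of (s,
    t).\<close>
  obtain z where z: "z \<in> rpoints (prod_ract I A)"
    using assms(2) by (auto simp: indecomposable_iff_conn right_act_def)
  have gi: "g x \<in> carrier S" if "k \<in> {i, j}" "x \<in> rpoints (A k)" for k x
    using g[OF that(1)] that(2) by blast
  have "(s, t) \<in> (\<lambda>x. (g (x i), g (x j))) ` rpoints (prod_ract I A)"
    if "s \<in> carrier S" "t \<in> carrier S" for s t
  proof -
    have "s \<in> g ` rpoints (A i)" "t \<in> g ` rpoints (A j)" using g that by simp_all
    then obtain a b where "a \<in> rpoints (A i)" "g a = s" "b \<in> rpoints (A j)" "g b = t" by blast
    then show ?thesis
      using ij z by (intro image_eqI[of _ _ "z(i := a, j := b)"])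
        (auto simp: prod_ract_def PiE_iff extensional_def)
  qed
  then show "(\<lambda>x. (g (x i), g (x j))) ` rpoints (prod_ract I A)
      = rpoints (pair_ract (regular_ract S) (regular_ract S))"
    using ij gi[of i] gi[of j] by (auto simp: prod_ract_def pair_ract_def regular_ract_def PiE_iff)
next
  fix x s assume "x \<in> rpoints (prod_ract I A)" "s \<in> carrier S"
  then show "(g (raction (prod_ract I A) x s i), g (raction (prod_ract I A) x s j))
      = raction (pair_ract (regular_ract S) (regular_ract S)) (g (x i), g (x j)) s"
    using hom[of i] hom[of j] ij by (auto simp: prod_ract_def pair_ract_def regular_ract_def PiE_iff)
qed

text \<open>For injective \<open>h\<close> this is an isomorphic copy of the regular act inside the
  type \<open>'u\<close>, over which the acts of the universally quantified conditions
  range.\<close>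

definition transported_ract ::
    "('s, 'm) monoid_scheme \<Rightarrow> ('s \<Rightarrow> 'u) \<Rightarrow> ('u, 's) ract" where
  "transported_ract S h =
     \<lparr>rpoints = h ` carrier S, raction = (\<lambda>a s. h (the_inv_into (carrier S) h a \<otimes>\<^bsub>S\<^esub> s))\<rparr>"

lemma cyclic_transported:
  assumes "monoid S" and inj: "inj_on h (carrier S)"
  shows "cyclic S (transported_ract S h)"
proof -
  interpret monoid S by fact
  have "right_act S (transported_ract S h)"
    unfolding right_act_def transported_ract_def
    using one_closed by (auto simp: the_inv_into_f_f[OF inj] m_assoc)
  moreover have "h \<one>\<^bsub>S\<^esub> \<in> rpoints (transported_ract S h)"
    by (simp add: transported_ract_def)
  moreover have "raction (transported_ract S h) (h \<one>\<^bsub>S\<^esub>) s = h s" if "s \<in> carrier S" for s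
    using that by (simp add: transported_ract_def the_inv_into_f_f[OF inj])
  then have "rpoints (transported_ract S h) = raction (transported_ract S h) (h \<one>\<^bsub>S\<^esub>) ` carrier S"
    by (simp add: transported_ract_def cong: image_cong)
  ultimately show ?thesis unfolding cyclic_def by blast
qed

lemma indecomposable_pair_of_transported:
  assumes "monoid S" and inj: "inj_on h (carrier S)"
    and "indecomposable S (prod_ract {0, 1 :: nat} (\<lambda>_. transported_ract S h))"
  shows "indecomposable S (pair_ract (regular_ract S) (regular_ract S))"
proof (rule indecomposable_pair_of_prod[OF assms(1,3), where i = 0 and j = 1])
  interpret monoid S by fact
  let ?g = "the_inv_into (carrier S) h"
  show "?g ` rpoints (transported_ract S h) = carrier S"
    by (simp add: transported_ract_def inj the_inv_into_onto)
  show "?g (raction (transported_ract S h) x s) = ?g x \<otimes>\<^bsub>S\<^esub> s"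
    if "x \<in> rpoints (transported_ract S h)" "s \<in> carrier S" for x s
    using that by (auto simp: transported_ract_def the_inv_into_f_f[OF inj])
qed auto

section \<open>Tensor products with the one-element act\<close>

lemma equiv_tensor_rel: "equiv UNIV (tensor_rel S A B)"
proof (rule equivI)
  show "refl (tensor_rel S A B)" by (simp add: tensor_rel_def refl_on_def)
  show "sym (tensor_rel S A B)" by (auto simp: tensor_rel_def intro: symI equivclp_sym)
  show "trans (tensor_rel S A B)"
    unfolding trans_def tensor_rel_def by (blast intro: equivclp_trans)
qed simp

text \<open>Since \<open>s\<close> fixes the single point (), a generating pair relates (as, ()) to
  (a, ()): it is a step read backwards.\<close>

lemma tensor_rel_one_iff:
  "((a, u), (b, v)) \<in> tensor_rel S A one_lact \<longleftrightarrow> act_conn S A a b"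
proof
  assume "((a, u), (b, v)) \<in> tensor_rel S A one_lact"
  then have "equivclp (tensor_gen S A one_lact) (a, u) (b, v)" by (simp add: tensor_rel_def)
  then have "act_conn S A (fst (a, u)) (fst (b, v))"
  proof (rule equivclp_map[where f = fst])
    fix p q assume "tensor_gen S A one_lact p q"
    then have "act_step S A (fst q) (fst p)"
      by (auto simp: tensor_gen_def act_step_def)
    then show "act_conn S A (fst p) (fst q)"
      by (intro equivclp_sym[OF r_into_equivclp])
  qed
  then show "act_conn S A a b" by simp
next
  assume "act_conn S A a b"
  then have "equivclp (tensor_gen S A one_lact) (a, ()) (b, ())"
  proof (rule equivclp_map[where f = "\<lambda>x. (x, ())"])
    fix x y assume "act_step S A x y"
    then have "tensor_gen S A one_lact (y, ()) (x, ())"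
      by (auto simp: tensor_gen_def act_step_def one_lact_def)
    then show "equivclp (tensor_gen S A one_lact) (x, ()) (y, ())"
      by (intro equivclp_sym[OF r_into_equivclp])
  qed
  then show "((a, u), (b, v)) \<in> tensor_rel S A one_lact" by (simp add: tensor_rel_def)
qed

lemma tensor_one_class_eq_iff:
  "tensor_rel S A one_lact `` {(a, u)} = tensor_rel S A one_lact `` {(b, v)} \<longleftrightarrow> act_conn S A a b"
  using eq_equiv_class_iff[OF equiv_tensor_rel, of "(a, u)" "(b, v)" S A one_lact]
  by (simp only: UNIV_I tensor_rel_one_iff)

lemma tensor_one:
  "tensor S A one_lact = (\<lambda>a. tensor_rel S A one_lact `` {(a, ())}) ` rpoints A"
  by (auto simp: tensor_def quotient_def one_lact_def)

lemma tensor_comparison_one: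
  assumes "x \<in> rpoints (prod_ract I A)"
  shows "tensor_comparison S I A one_lact (tensor_rel S (prod_ract I A) one_lact `` {(x, ())})
    = (\<lambda>i\<in>I. tensor_rel S (A i) one_lact `` {(x i, ())})"
  unfolding tensor_comparison_def
proof (rule restrict_ext)
  fix i assume i: "i \<in> I"
  \<comment> \<open>Projections preserve zigzags, so every representative yields the same class, and
    the union in \<open>tensor_map\<close> collapses to it once it is known to be nonempty.\<close>
  have *: "tensor_rel S (A i) one_lact `` {(y i, u)} = tensor_rel S (A i) one_lact `` {(x i, ())}"
    if "((x, ()), (y, u)) \<in> tensor_rel S (prod_ract I A) one_lact" for y u
  proof -
    have "act_conn S (prod_ract I A) x y" using that by (simp only: tensor_rel_one_iff)
    then have "act_conn S (A i) (x i) (y i)"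
      by (rule act_conn_hom[where f = "\<lambda>x. x i"]) (use i in \<open>auto simp: prod_ract_def\<close>)
    then show ?thesis unfolding tensor_one_class_eq_iff by (rule equivclp_sym)
  qed
  have "((x, ()), (x, ())) \<in> tensor_rel S (prod_ract I A) one_lact"
    by (simp add: tensor_rel_def)
  then show "tensor_map S (A i) one_lact (\<lambda>a. a i)
      (tensor_rel S (prod_ract I A) one_lact `` {(x, ())}) = tensor_rel S (A i) one_lact `` {(x i, ())}"
    unfolding tensor_map_def using * by fast
qed

text \<open>The comparison map is always surjective, as representatives can be chosen
  coordinatewise. Only injectivity is at stake: points with connected coordinates must be connected
  in the product.\<close>

lemma bij_betw_tensor_comparison_one:
  "bij_betw (tensor_comparison S I A one_lact)
      (tensor S (prod_ract I A) one_lact) (\<Pi>\<^sub>E i\<in>I. tensor S (A i) one_lact) \<longleftrightarrow>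
    (\<forall>x\<in>rpoints (prod_ract I A). \<forall>y\<in>rpoints (prod_ract I A).
      (\<forall>i\<in>I. act_conn S (A i) (x i) (y i)) \<longrightarrow> act_conn S (prod_ract I A) x y)"
    (is "?bij \<longleftrightarrow> ?conn")
proof -
  let ?P = "prod_ract I A" and ?cmp = "tensor_comparison S I A one_lact"
  let ?cl = "\<lambda>x. tensor_rel S (prod_ract I A) one_lact `` {(x, ())}"
  let ?cli = "\<lambda>i a. tensor_rel S (A i) one_lact `` {(a, ())}"
  have surj: "?cmp ` tensor S ?P one_lact = (\<Pi>\<^sub>E i\<in>I. tensor S (A i) one_lact)"
  proof
    show "?cmp ` tensor S ?P one_lact \<subseteq> (\<Pi>\<^sub>E i\<in>I. tensor S (A i) one_lact)"
      by (auto simp: tensor_one tensor_comparison_one) (auto simp: prod_ract_def)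
    show "(\<Pi>\<^sub>E i\<in>I. tensor S (A i) one_lact) \<subseteq> ?cmp ` tensor S ?P one_lact"
    proof
      fix t assume t: "t \<in> (\<Pi>\<^sub>E i\<in>I. tensor S (A i) one_lact)"
      then have "\<forall>i\<in>I. \<exists>a\<in>rpoints (A i). t i = ?cli i a"
        by (auto simp: tensor_one PiE_iff)
      then obtain x where x: "\<And>i. i \<in> I \<Longrightarrow> x i \<in> rpoints (A i) \<and> t i = ?cli i (x i)"
        using bchoice[of I "\<lambda>i a. a \<in> rpoints (A i) \<and> t i = ?cli i a"] by blast
      then have mem: "restrict x I \<in> rpoints ?P" by (simp add: prod_ract_def)
      have "t = (\<lambda>i\<in>I. ?cli i (restrict x I i))"
        using t x by (intro ext) (auto simp: PiE_iff extensional_def)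
      then have "t = ?cmp (?cl (restrict x I))"
        unfolding tensor_comparison_one[OF mem] .
      then show "t \<in> ?cmp ` tensor S ?P one_lact"
        using mem unfolding tensor_one by blast
    qed
  qed
  have cmp_eq: "?cmp (?cl x) = ?cmp (?cl y) \<longleftrightarrow> (\<forall>i\<in>I. act_conn S (A i) (x i) (y i))"
    if "x \<in> rpoints ?P" "y \<in> rpoints ?P" for x y
  proof -
    have "?cmp (?cl x) = ?cmp (?cl y) \<longleftrightarrow> (\<forall>i\<in>I. ?cli i (x i) = ?cli i (y i))"
      unfolding tensor_comparison_one[OF that(1)] tensor_comparison_one[OF that(2)]
      by (metis (no_types, lifting) restrict_apply' restrict_ext)
    then show ?thesis unfolding tensor_one_class_eq_iff .
  qed
  have "?bij \<longleftrightarrow> inj_on ?cmp (tensor S ?P one_lact)" using surj by (simp add: bij_betw_def)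
  also have "\<dots> \<longleftrightarrow> (\<forall>x\<in>rpoints ?P. \<forall>y\<in>rpoints ?P.
      ?cmp (?cl x) = ?cmp (?cl y) \<longrightarrow> ?cl x = ?cl y)"
    unfolding inj_on_def tensor_one by blast
  also have "\<dots> \<longleftrightarrow> ?conn"
    unfolding tensor_one_class_eq_iff using cmp_eq by blast
  finally show ?thesis .
qed

lemma left_act_one: "left_act S one_lact"
  by (simp add: left_act_def one_lact_def)

(* HOL cannot quantify over types inside a formula, so "all right S-acts" means all right
   S-acts whose points lie in an arbitrary type 'u; the second assumption only says that 'u
   is large enough to contain a copy of S. *)
theorem theorem3p2:
  fixes S :: "('s, 'm) monoid_scheme"
  assumes "monoid S"
    and "carrier S \<lesssim> (UNIV :: 'u set)"
  shows
    "((\<forall>(I :: nat set) (A :: nat \<Rightarrow> ('u, 's) ract).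
         finite I \<and> (\<forall>i\<in>I. indecomposable S (A i)) \<longrightarrow> indecomposable S (prod_ract I A))
       \<longleftrightarrow> indecomposable S (pair_ract (regular_ract S) (regular_ract S))) \<and>
     ((\<forall>(I :: nat set) (A :: nat \<Rightarrow> ('u, 's) ract).
         finite I \<and> (\<forall>i\<in>I. cyclic S (A i)) \<longrightarrow> indecomposable S (prod_ract I A))
       \<longleftrightarrow> indecomposable S (pair_ract (regular_ract S) (regular_ract S))) \<and>
     ((\<forall>n\<ge>1. indecomposable S (power_ract S n))
       \<longleftrightarrow> indecomposable S (pair_ract (regular_ract S) (regular_ract S))) \<and>
     ((\<exists>n\<ge>1. n \<noteq> 1 \<and> indecomposable S (power_ract S n))
       \<longleftrightarrow> indecomposable S (pair_ract (regular_ract S) (regular_ract S))) \<and>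
     (finitely_product_flat TYPE('u) S (one_lact :: (unit, 's) lact)
       \<longleftrightarrow> indecomposable S (pair_ract (regular_ract S) (regular_ract S)))"
proof -
  let ?SS = "indecomposable S (pair_ract (regular_ract S) (regular_ract S))"
  let ?i = "\<forall>(I :: nat set) (A :: nat \<Rightarrow> ('u, 's) ract).
    finite I \<and> (\<forall>i\<in>I. indecomposable S (A i)) \<longrightarrow> indecomposable S (prod_ract I A)"
  let ?ii = "\<forall>(I :: nat set) (A :: nat \<Rightarrow> ('u, 's) ract).
    finite I \<and> (\<forall>i\<in>I. cyclic S (A i)) \<longrightarrow> indecomposable S (prod_ract I A)"
  let ?iii = "\<forall>n\<ge>1. indecomposable S (power_ract S n)"
  let ?iv = "\<exists>n\<ge>1. n \<noteq> 1 \<and> indecomposable S (power_ract S n)"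
  let ?vi = "finitely_product_flat TYPE('u) S (one_lact :: (unit, 's) lact)"
  \<comment> \<open>The cardinality assumption enters here; it provides a copy of S as a test act
    for the conditions that quantify over acts in \<open>'u\<close>.\<close>
  obtain h :: "'s \<Rightarrow> 'u" where h: "inj_on h (carrier S)"
    using assms(2) by (auto simp: lepoll_def)
  let ?C = "transported_ract S h"
  have C: "cyclic S ?C" by (rule cyclic_transported[OF assms(1) h])
  have v_i: ?i if ?SS using indecomposable_prod[OF assms(1) that] by blast
  have i_ii: ?ii if ?i using that cyclic_imp_indecomposable by blast
  have ii_v: ?SS if ?ii
    by (rule indecomposable_pair_of_transported[OF assms(1) h]) (use that C in simp)
  have v_iii: ?iii if ?SS
    unfolding power_ract_def
    by (intro allI impI indecomposable_prod[OF assms(1) that] finite_atLeastAtMost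
      cyclic_imp_indecomposable[OF cyclic_regular[OF assms(1)]])
  have iii_iv: ?iv if ?iii using that by (intro exI[of _ 2]) simp
  have iv_v: ?SS if iv: ?iv
  proof -
    \<comment> \<open>Here n is at least 2, so 1 and 2 are both indices of the power, and projecting
      to them gives S \<times> S.\<close>
    obtain n where n: "n \<ge> 1" "n \<noteq> 1" "indecomposable S (power_ract S n)" using iv by blast
    show ?thesis
      by (rule indecomposable_pair_of_prod[OF assms(1) n(3)[unfolded power_ract_def],
            where i = 1 and j = 2 and g = id])
        (use n in \<open>auto simp: regular_ract_def\<close>)
  qed
  have v_vi: ?vi if ?SS
    unfolding finitely_product_flat_def bij_betw_tensor_comparison_one
    by (intro conjI allI impI ballI left_act_one act_conn_prod[OF assms(1) that]) auto
  \<comment> \<open>Flatness is applied to two copies of S. Each copy is connected, so any two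
    points of the product are connected coordinatewise and hence, by flatness, connected.\<close>
  have vi_v: ?SS if vi: ?vi
  proof (rule indecomposable_pair_of_transported[OF assms(1) h])
    let ?P = "prod_ract {0, 1 :: nat} (\<lambda>_. ?C)"
    have ind: "indecomposable S ?C" using C by (rule cyclic_imp_indecomposable)
    then have act: "right_act S ?C" by (simp add: indecomposable_iff_conn)
    have "finite {0, 1 :: nat} \<and> (\<forall>i\<in>{0, 1 :: nat}. right_act S ?C)" using act by simp
    then have *: "\<forall>x\<in>rpoints ?P. \<forall>y\<in>rpoints ?P.
        (\<forall>i\<in>{0, 1}. act_conn S ?C (x i) (y i)) \<longrightarrow> act_conn S ?P x y"
      using vi unfolding finitely_product_flat_def bij_betw_tensor_comparison_one
      by (elim conjE allE[of _ "{0, 1}"] allE[of _ "\<lambda>_. ?C"]) (erule mp, simp)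
    show "indecomposable S ?P"
      unfolding indecomposable_iff_conn
    proof (intro conjI ballI)
      show "right_act S ?P" by (intro right_act_prod assms(1) act)
      fix x y assume xy: "x \<in> rpoints ?P" "y \<in> rpoints ?P"
      then have "\<forall>i\<in>{0, 1}. act_conn S ?C (x i) (y i)"
        using ind by (simp add: indecomposable_iff_conn prod_ract_def PiE_iff)
      with * xy show "act_conn S ?P x y" by blast
    qed
  qed
  \<comment> \<open>Two cycles meet in S \<times> S: (v), (i), (ii), (v) and (v), (iii), (iv), (v);
    condition (vi) is linked to (v) directly.\<close>
  show ?thesis
    by (intro conjI iffI)
      (erule v_i ii_v[OF i_ii] i_ii[OF v_i] ii_v v_iii iv_v[OF iii_iv] iii_iv[OF v_iii] iv_v v_vi vi_v)+
qed

end
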